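(* The portrait growth sequence $\{a_n\}_{n=0}^{\infty}$ of the Apollonian group $\mathcal{A}$ (with respect to the nucleus of $\mathcal{A}$) is given, for all $n\ge 0$, by $$a_{n}=3^{\frac{3^n-1}{2}} \cdot 7^{3^n} = \frac{1}{\sqrt{3}}\left( 7 \sqrt{3} \right)^{3^n}.$$
   Context: Let $X=\{1,\dots,d\}$ and let $T$ be the $d$-adic rooted tree whose vertices are the finite words over $X$, with $u$ joined to $ux$ for $x \in X$; words of length $n$ form level $n$. $\operatorname{Aut} T$ is the group of automorphisms of this rooted tree. Every $g\in\operatorname{Aut} T$ is written $g=(g_1,\dots,g_d)\alpha$ with $\alpha\in S_d$ and $g_i\in \operatorname{Aut} T$, meaning $g(iw)=\alpha(i)\,g_i(w)$ for $i\in X$ and every word $w$; $g_i$ is the section of $g$ at $i$. The section $g_u$ at any vertex $u$ is defined by $g(uw)=g(u)g_u(w)$. Products are composed so that $gh$ means first $g$, then $h$, i.e. $(gh)_u=g_u h_{g(u)}$. A group $G\le\operatorname{Aut} T$ is self-similar if all sections of its elements lie in $G$. A self-similar group $G$ is contracting if there is a finite set $\mathcal{M}\subseteq G$ such that for every $g\in G$ there is a level $n$ such that all sections of $g$ at vertices at and below level $n$ belong to $\mathcal{M}$. The smallest such $\mathcal{M}$ is the nucleus $\mathcal{N}(G)$. For a contracting group $G$, the nucleus portrait of $g\in G$ is the finite decorated rooted tree defined recursively: if $g\in\mathcal{N}(G)$, it is a single root decorated by $g$; otherwise, with $g=(g_1,\dots,g_d)\alpha$, the root is decorated by $\alpha$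 and the portraits of $g_1,\dots,g_d$ are attached at the $d$ vertices of level 1. The depth $d(g)$ is the length of the longest path from the root to a leaf of the portrait (equivalently, the least $n$ such that all sections of $g$ at level $n$ lie in $\mathcal{N}(G)$). The portrait growth sequence of a finitely generated contracting group $G$ is $a_n=|\{g\in G\mid d(g)\le n\}|$, $n\ge 0$. The Apollonian group $\mathcal{A}$ is the group of automorphisms of the ternary tree ($d=3$) generated by the automorphisms defined recursively by $$x=(1,y,1)(1\,2),\qquad y=(x,1,1)(1\,3),\qquad z=(1,1,z)(2\,3).$$ It is contracting with nucleus $\{1,x,y,z,x^{-1},y^{-1},z^{-1}\}$. *)

theory Defs
  imports Complex_Main "HOL-Algebra.Generated_Groups" "HOL-Combinatorics.Transposition"
begin

section \<open>The rooted tree of words and its automorphism group\<close>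

text \<open>The alphabet \<open>X\<close> is a finite type \<open>'x\<close> (of \<open>d\<close> letters); the vertices of \<open>T\<close> are all lists over it.\<close>

definition tree_adj :: "'x list \<Rightarrow> 'x list \<Rightarrow> bool" where
  "tree_adj u v \<longleftrightarrow> (\<exists>i. v = u @ [i] \<or> u = v @ [i])"

definition tree_aut :: "('x list \<Rightarrow> 'x list) \<Rightarrow> bool" where
  "tree_aut g \<longleftrightarrow> bij g \<and> g [] = [] \<and> (\<forall>u v. tree_adj (g u) (g v) \<longleftrightarrow> tree_adj u v)"

text \<open>The product of \<open>g\<close> and \<open>h\<close> is first \<open>g\<close>, then \<open>h\<close>.\<close>

definition AutT :: "('x list \<Rightarrow> 'x list) monoid" where
  "AutT = \<lparr>carrier = {g. tree_aut g}, mult = (\<lambda>g h. h \<circ> g), one = id\<rparr>"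

text \<open>The section at \<open>u\<close> is determined by \<open>g (u @ w) = g u @ sect g u w\<close>, since \<open>g u\<close> is the prefix
  of \<open>g (u @ w)\<close> of the same length as \<open>u\<close>; see \<open>tree_aut_append\<close> below.\<close>

definition sect :: "('x list \<Rightarrow> 'x list) \<Rightarrow> 'x list \<Rightarrow> 'x list \<Rightarrow> 'x list" where
  "sect g u w = drop (length u) (g (u @ w))"

definition root_perm :: "('x list \<Rightarrow> 'x list) \<Rightarrow> 'x \<Rightarrow> 'x" where
  "root_perm g i = hd (g [i])"

lemma tree_aut_length: "tree_aut g \<Longrightarrow> length (g u) = length u"
  and tree_aut_snoc: "tree_aut g \<Longrightarrow> \<exists>j. g (u @ [i]) = g u @ [j]"
proof -
  assume g: "tree_aut g"
  have inj: "inj g" and nil: "g [] = []"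
    and adj: "\<And>u v. tree_adj (g u) (g v) \<longleftrightarrow> tree_adj u v"
    using g by (auto simp: tree_aut_def bij_def)
  have step: "\<exists>j. g (u @ [i]) = g u @ [j]" for u i
  proof (induction u arbitrary: i rule: rev_induct)
    case Nil
    have "tree_adj (g []) (g [i])" by (subst adj) (auto simp: tree_adj_def)
    then show ?case by (auto simp: nil tree_adj_def)
  next
    case (snoc a u)
    obtain j where j: "g (u @ [a]) = g u @ [j]" using snoc by blast
    have "tree_adj (g (u @ [a])) (g (u @ [a] @ [i]))"
      unfolding adj by (auto simp: tree_adj_def)
    then consider k where "g (u @ [a] @ [i]) = g (u @ [a]) @ [k]"
      | k where "g (u @ [a]) = g (u @ [a] @ [i]) @ [k]"
      by (auto simp: tree_adj_def)
    then show ?case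
    proof cases
      case 1
      then show ?thesis by simp
    next
      case 2
      then have "g u = g (u @ [a] @ [i])" using j by simp
      then show ?thesis using inj by (auto dest: injD)
    qed
  qed
  show "\<exists>j. g (u @ [i]) = g u @ [j]" by (rule step)
  show "length (g u) = length u"
  proof (induction u rule: rev_induct)
    case (snoc i u)
    then show ?case using step[of u i] by auto
  qed (simp add: nil)
qed

lemma tree_aut_append:
  assumes "tree_aut g"
  shows "g (u @ w) = g u @ sect g u w"
proof -
  have "\<exists>v. g (u @ w) = g u @ v"
  proof (induction w rule: rev_induct)
    case (snoc i w)
    then show ?case using tree_aut_snoc[OF assms, of "u @ w" i] by auto
  qed simp
  then show ?thesis
    using tree_aut_length[OF assms, of u] by (auto simp: sect_def)
qed

lemma tree_autI:
  assumes "bij g" and nil: "g [] = []" and step: "\<And>u i. \<exists>j. g (u @ [i]) = g u @ [j]"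
  shows "tree_aut g"
proof -
  have inj: "inj g" using assms(1) by (simp add: bij_def)
  have 1: "\<exists>i. v = u @ [i]" if "g v = g u @ [j]" for u v j
  proof (cases v rule: rev_cases)
    case Nil
    then show ?thesis using that nil by simp
  next
    case (snoc v' i)
    then obtain k where "g v = g v' @ [k]" using step by blast
    then have "g v' = g u" using that by simp
    then show ?thesis using snoc inj by (auto dest: injD)
  qed
  have "tree_adj (g u) (g v) \<longleftrightarrow> tree_adj u v" for u v
  proof
    assume "tree_adj (g u) (g v)"
    then show "tree_adj u v" using 1 unfolding tree_adj_def by blast
  next
    assume "tree_adj u v"
    then show "tree_adj (g u) (g v)" using step unfolding tree_adj_def by blast
  qed
  then show ?thesis using assms by (simp add: tree_aut_def)
qed

lemma group_AutT: "group AutT"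
proof (rule groupI)
  fix g :: "'a list \<Rightarrow> 'a list"
  assume "g \<in> carrier AutT"
  then have g: "tree_aut g" by (simp add: AutT_def)
  then have b: "bij g" by (simp add: tree_aut_def)
  let ?h = "inv_into UNIV g"
  have [simp]: "g (?h v) = v" "?h (g v) = v" for v
    using b by (simp_all add: bij_def surj_f_inv_f)
  have nil: "?h [] = []"
    using g b by (metis bij_def inv_f_f tree_aut_def)
  have "tree_adj (?h u) (?h v) \<longleftrightarrow> tree_adj u v" for u v
    using g unfolding tree_aut_def by (metis \<open>\<And>v. g (?h v) = v\<close>)
  then have "tree_aut (?h)"
    using b nil by (simp add: tree_aut_def bij_imp_bij_inv)
  moreover have "g \<circ> ?h = id" by (simp add: fun_eq_iff)
  ultimately show "\<exists>h\<in>carrier AutT. h \<otimes>\<^bsub>AutT\<^esub> g = \<one>\<^bsub>AutT\<^esub>"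
    by (auto simp: AutT_def)
qed (auto simp: AutT_def tree_aut_def bij_comp comp_assoc)

section \<open>Contracting groups, nucleus and portraits\<close>

definition self_similar :: "('x list \<Rightarrow> 'x list) set \<Rightarrow> bool" where
  "self_similar G \<longleftrightarrow> subgroup G AutT \<and> (\<forall>g\<in>G. \<forall>u. sect g u \<in> G)"

definition contracts_to :: "('x list \<Rightarrow> 'x list) set \<Rightarrow> ('x list \<Rightarrow> 'x list) set \<Rightarrow> bool" where
  "contracts_to G M \<longleftrightarrow> finite M \<and> M \<subseteq> G \<and>
     (\<forall>g\<in>G. \<exists>n. \<forall>u. length u \<ge> n \<longrightarrow> sect g u \<in> M)"

definition contracting :: "('x list \<Rightarrow> 'x list) set \<Rightarrow> bool" where
  "contracting G \<longleftrightarrow> self_similar G \<and> (\<exists>M. contracts_to G M)"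

text \<open>Least with respect to inclusion.\<close>

definition nucleus :: "('x list \<Rightarrow> 'x list) set \<Rightarrow> ('x list \<Rightarrow> 'x list) set" where
  "nucleus G = (LEAST M. contracts_to G M)"

lemma nucleus_least:
  fixes G :: "('x::finite list \<Rightarrow> 'x list) set"
  assumes "contracting G"
  shows "contracts_to G (nucleus G)" and "contracts_to G M \<Longrightarrow> nucleus G \<subseteq> M"
proof -
  define N where "N = \<Inter>{M. contracts_to G M}"
  obtain M0 where M0: "contracts_to G M0" using assms by (auto simp: contracting_def)
  have inter: "contracts_to G (A \<inter> B)" if ab: "contracts_to G A" "contracts_to G B" for A B
    unfolding contracts_to_def
  proof (intro conjI ballI)
    fix g assume "g \<in> G"
    then obtain m n where "\<forall>u. length u \<ge> m \<longrightarrow> sect g u \<in> A" "\<forall>u. length u \<ge> n \<longrightarrow> sect g u \<in> B"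
      using ab unfolding contracts_to_def by meson
    then show "\<exists>n. \<forall>u. length u \<ge> n \<longrightarrow> sect g u \<in> A \<inter> B"
      by (intro exI[of _ "max m n"]) auto
  qed (use ab in \<open>auto simp: contracts_to_def\<close>)
  have fin: "finite {M \<inter> M0 |M. contracts_to G M}"
    by (rule finite_subset[of _ "Pow M0"]) (use M0 in \<open>auto simp: contracts_to_def\<close>)
  have "contracts_to G (\<Inter>F)" if "finite F" "F \<noteq> {}" "\<forall>A\<in>F. contracts_to G A" for F
    using that by (induction F rule: finite_ne_induct) (auto intro: inter)
  from this[OF fin] M0 inter have "contracts_to G (\<Inter>{M \<inter> M0 |M. contracts_to G M})"
    by blast
  also have "\<Inter>{M \<inter> M0 |M. contracts_to G M} = N"
    using M0 unfolding N_def by auto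
  finally have N: "contracts_to G N" .
  have min: "N \<subseteq> M" if "contracts_to G M" for M using that by (auto simp: N_def)
  have "nucleus G = N" unfolding nucleus_def by (rule Least_equality) (rule N, rule min)
  then show "contracts_to G (nucleus G)" "contracts_to G M \<Longrightarrow> nucleus G \<subseteq> M"
    using N min by auto
qed

text \<open>A portrait is a tree whose leaves carry elements of the nucleus and whose inner vertices carry
  permutations of \<open>X\<close>; the subtrees of an inner vertex are indexed by \<open>X\<close>.\<close>

datatype 'x portrait =
    Leaf "'x list \<Rightarrow> 'x list"
  | Node "'x \<Rightarrow> 'x" "'x \<Rightarrow> 'x portrait"

inductive has_portrait ::
  "('x list \<Rightarrow> 'x list) set \<Rightarrow> ('x list \<Rightarrow> 'x list) \<Rightarrow> 'x portrait \<Rightarrow> bool" for N where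
  leaf: "g \<in> N \<Longrightarrow> has_portrait N g (Leaf g)"
| node: "g \<notin> N \<Longrightarrow> (\<And>i. has_portrait N (sect g [i]) (p i)) \<Longrightarrow>
     has_portrait N g (Node (root_perm g) p)"

lemma has_portrait_unique: "has_portrait N g p \<Longrightarrow> has_portrait N g q \<Longrightarrow> p = q"
proof (induction arbitrary: q rule: has_portrait.induct)
  case (leaf g)
  then show ?case by (auto elim: has_portrait.cases)
next
  case (node g p)
  from node.prems node.hyps obtain p' where
    "q = Node (root_perm g) p'" "\<And>i. has_portrait N (sect g [i]) (p' i)"
    by (auto elim: has_portrait.cases)
  then show ?case using node.IH by auto
qed

definition nucleus_portrait ::
  "('x list \<Rightarrow> 'x list) set \<Rightarrow> ('x list \<Rightarrow> 'x list) \<Rightarrow> 'x portrait" where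
  "nucleus_portrait G g = (THE p. has_portrait (nucleus G) g p)"

text \<open>The length of a longest path from the root to a leaf.\<close>

primrec portrait_depth :: "'x::finite portrait \<Rightarrow> nat" where
  "portrait_depth (Leaf g) = 0"
| "portrait_depth (Node \<alpha> p) = Suc (Max (range (\<lambda>i. portrait_depth (p i))))"

definition depth :: "('x::finite list \<Rightarrow> 'x list) set \<Rightarrow> ('x list \<Rightarrow> 'x list) \<Rightarrow> nat" where
  "depth G g = portrait_depth (nucleus_portrait G g)"

definition portrait_growth :: "('x::finite list \<Rightarrow> 'x list) set \<Rightarrow> nat \<Rightarrow> nat" where
  "portrait_growth G n = card {g \<in> G. depth G g \<le> n}"

section \<open>The Apollonian group\<close>

datatype letter = X1 | X2 | X3

lemma UNIV_letter: "UNIV = {X1, X2, X3}"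
  by (auto intro: letter.exhaust)

instance letter :: finite
  by standard (simp add: UNIV_letter)

fun apo_x :: "letter list \<Rightarrow> letter list" and apo_y :: "letter list \<Rightarrow> letter list" where
  "apo_x [] = []"
| "apo_x (X1 # w) = X2 # w"
| "apo_x (X2 # w) = X1 # apo_y w"
| "apo_x (X3 # w) = X3 # w"
| "apo_y [] = []"
| "apo_y (X1 # w) = X3 # apo_x w"
| "apo_y (X2 # w) = X2 # w"
| "apo_y (X3 # w) = X1 # w"

fun apo_z :: "letter list \<Rightarrow> letter list" where
  "apo_z [] = []"
| "apo_z (X1 # w) = X1 # w"
| "apo_z (X2 # w) = X3 # w"
| "apo_z (X3 # w) = X2 # apo_z w"

text \<open>These are \<open>x = (1,y,1)(1 2)\<close>, \<open>y = (x,1,1)(1 3)\<close> and \<open>z = (1,1,z)(2 3)\<close>:\<close>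

lemma apo_wreath:
  "sect apo_x [X1] = id" "sect apo_x [X2] = apo_y" "sect apo_x [X3] = id"
  "root_perm apo_x = transpose X1 X2"
  "sect apo_y [X1] = apo_x" "sect apo_y [X2] = id" "sect apo_y [X3] = id"
  "root_perm apo_y = transpose X1 X3"
  "sect apo_z [X1] = id" "sect apo_z [X2] = id" "sect apo_z [X3] = apo_z"
  "root_perm apo_z = transpose X2 X3"
proof -
  have "root_perm apo_x i = transpose X1 X2 i" "root_perm apo_y i = transpose X1 X3 i"
    "root_perm apo_z i = transpose X2 X3 i" for i
    by (cases i; simp add: root_perm_def transpose_def)+
  then show "root_perm apo_x = transpose X1 X2" "root_perm apo_y = transpose X1 X3"
    "root_perm apo_z = transpose X2 X3" by auto
qed (auto simp: sect_def fun_eq_iff)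

definition apollonian :: "(letter list \<Rightarrow> letter list) set" where
  "apollonian = generate AutT {apo_x, apo_y, apo_z}"

lemma apo_tree_aut: "tree_aut apo_x" "tree_aut apo_y" "tree_aut apo_z"
proof -
  have inj_xy: "\<forall>v. (apo_x u = apo_x v \<longrightarrow> u = v) \<and> (apo_y u = apo_y v \<longrightarrow> u = v)" for u
  proof (induction u)
    case Nil
    show ?case
    proof
      fix v show "(apo_x [] = apo_x v \<longrightarrow> [] = v) \<and> (apo_y [] = apo_y v \<longrightarrow> [] = v)"
        by (cases v; cases "hd v"; simp)
    qed
  next
    case (Cons i u)
    show ?case
    proof
      fix v show "(apo_x (i # u) = apo_x v \<longrightarrow> i # u = v) \<and> (apo_y (i # u) = apo_y v \<longrightarrow> i # u = v)"
        using Cons by (cases i; cases v; cases "hd v"; simp)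
    qed
  qed
  have inj_z: "\<forall>v. apo_z u = apo_z v \<longrightarrow> u = v" for u
  proof (induction u)
    case Nil
    show ?case
    proof
      fix v show "apo_z [] = apo_z v \<longrightarrow> [] = v" by (cases v; cases "hd v"; simp)
    qed
  next
    case (Cons i u)
    show ?case
    proof
      fix v show "apo_z (i # u) = apo_z v \<longrightarrow> i # u = v"
        using Cons by (cases i; cases v; cases "hd v"; simp)
    qed
  qed
  have surj_xy: "(\<exists>u. apo_x u = v) \<and> (\<exists>u. apo_y u = v)" for v
  proof (induction v)
    case (Cons i v)
    then show ?case
      by (cases i) (metis apo_x.simps apo_y.simps)+
  qed (auto intro: exI[of _ "[]"])
  have surj_z: "\<exists>u. apo_z u = v" for v
  proof (induction v)
    case (Cons i v)
    then show ?case by (cases i) (metis apo_z.simps)+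
  qed (auto intro: exI[of _ "[]"])
  have step_xy: "(\<exists>j. apo_x (u @ [i]) = apo_x u @ [j]) \<and> (\<exists>j. apo_y (u @ [i]) = apo_y u @ [j])" for u i
  proof (induction u)
    case Nil
    show ?case by (cases i) auto
  next
    case (Cons k u)
    then show ?case by (cases k) auto
  qed
  have step_z: "\<exists>j. apo_z (u @ [i]) = apo_z u @ [j]" for u i
  proof (induction u)
    case Nil
    show ?case by (cases i) auto
  next
    case (Cons k u)
    then show ?case by (cases k) auto
  qed
  have "bij apo_x" "bij apo_y" "bij apo_z"
    unfolding bij_def inj_def surj_def using inj_xy inj_z surj_xy surj_z by metis+
  then show "tree_aut apo_x" "tree_aut apo_y" "tree_aut apo_z"
    using step_xy step_z by (auto intro!: tree_autI)
qed

lemma subgroup_apollonian: "subgroup apollonian AutT"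
  unfolding apollonian_def
  by (rule group.generate_is_subgroup[OF group_AutT]) (auto simp: AutT_def apo_tree_aut)

end

theory Submission
  imports Defs "HOL-Combinatorics.Permutations" "HOL-Library.FuncSet"
begin

text \<open>
  Call an element even if its action on the first level is even. Each generator \<open>s\<close> has a single
  nontrivial section, which is again odd, so the parity of \<open>g = (g\<^sub>1, g\<^sub>2, g\<^sub>3)\<alpha>\<close> in the group is the
  product of the parities of its sections. This is the only constraint: explicit words show that
  \<open>(g, 1, 1)\<close> lies in the group for \<open>g = x\<^sup>2, xy, xz, yx\<^sup>-\<^sup>1, zx\<^sup>-\<^sup>1\<close>, hence for every even \<open>g\<close>, and the
  squares \<open>x\<^sup>2 = (y, y, 1)\<close>, \<open>y\<^sup>2 = (x, 1, x)\<close>, \<open>z\<^sup>2 = (1, z, z)\<close> realise the remaining patterns of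
  parities. Thus any three elements of the group are the sections of exactly three elements, one for
  each \<open>\<alpha>\<close> of the right parity, whence \<open>a\<^bsub>n+1\<^esub> = 3 a\<^sub>n\<^sup>3\<close> and \<open>a\<^sub>0 = 7\<close>.
\<close>

section \<open>Wreath recursion\<close>

text \<open>Assembles a map from prescribed sections and a root permutation. Both are arbitrary
  functions here, so membership of the result in a group is a genuine condition on them.\<close>

fun wreath :: "('x \<Rightarrow> 'x list \<Rightarrow> 'x list) \<Rightarrow> ('x \<Rightarrow> 'x) \<Rightarrow> 'x list \<Rightarrow> 'x list" where
  "wreath s \<alpha> [] = []"
| "wreath s \<alpha> (i # w) = \<alpha> i # s i w"

lemma wreath_comp: "wreath t \<beta> \<circ> wreath s \<alpha> = wreath (\<lambda>i. t (\<alpha> i) \<circ> s i) (\<beta> \<circ> \<alpha>)"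
proof
  fix w show "(wreath t \<beta> \<circ> wreath s \<alpha>) w = wreath (\<lambda>i. t (\<alpha> i) \<circ> s i) (\<beta> \<circ> \<alpha>) w"
    by (cases w) auto
qed

lemma wreath_id: "wreath (\<lambda>_. id) id = id"
proof
  fix w :: "'a list" show "wreath (\<lambda>_. id) id w = id w" by (cases w) auto
qed

lemma sect_wreath [simp]: "sect (wreath s \<alpha>) [i] = s i"
  by (auto simp: sect_def)

lemma root_perm_wreath [simp]: "root_perm (wreath s \<alpha>) = \<alpha>"
  by (auto simp: root_perm_def)

lemma sect_Nil [simp]: "sect g [] = g"
  by (auto simp: sect_def)

lemma sect_append: "sect g (u @ v) = sect (sect g u) v"
  by (auto simp: sect_def add.commute)

lemma sect_Cons: "sect g (i # u) = sect (sect g [i]) u"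
  using sect_append[of g "[i]" u] by simp

lemma sect_id [simp]: "sect id u = id"
  by (auto simp: sect_def)

lemma root_perm_id [simp]: "root_perm id = id"
  by (auto simp: root_perm_def)

lemma tree_aut_singleton: "tree_aut g \<Longrightarrow> g [i] = [root_perm g i]"
  using tree_aut_length[of g "[i]"] by (cases "g [i]") (auto simp: root_perm_def)

lemma tree_aut_eq_wreath:
  assumes "tree_aut g"
  shows "g = wreath (\<lambda>i. sect g [i]) (root_perm g)"
proof
  fix w show "g w = wreath (\<lambda>i. sect g [i]) (root_perm g) w"
  proof (cases w)
    case Nil
    then show ?thesis using assms by (simp add: tree_aut_def)
  next
    case (Cons i v)
    then show ?thesis
      using tree_aut_append[OF assms, of "[i]" v] tree_aut_singleton[OF assms, of i] by simp
  qed
qed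

lemma sect_comp:
  assumes "tree_aut g" "tree_aut h"
  shows "sect (h \<circ> g) u = sect h (g u) \<circ> sect g u"
proof
  fix w
  have "h (g (u @ w)) = h (g u) @ sect h (g u) (sect g u w)"
    by (metis assms tree_aut_append)
  then show "sect (h \<circ> g) u w = (sect h (g u) \<circ> sect g u) w"
    using assms by (simp add: sect_def[of "h \<circ> g"] tree_aut_length)
qed

lemma root_perm_comp:
  assumes "tree_aut g" "tree_aut h"
  shows "root_perm (h \<circ> g) = root_perm h \<circ> root_perm g"
  using tree_aut_singleton[OF assms(1)] tree_aut_singleton[OF assms(2)]
  by (auto simp: root_perm_def fun_eq_iff)

lemma bij_root_perm:
  fixes g :: "'x::finite list \<Rightarrow> 'x list"
  assumes "tree_aut g"
  shows "bij (root_perm g)"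
proof -
  have "inj (root_perm g)"
  proof (rule injI)
    fix i j assume "root_perm g i = root_perm g j"
    then have "g [i] = g [j]" using assms by (simp add: tree_aut_singleton)
    then show "i = j" using assms by (auto simp: tree_aut_def bij_def dest: injD)
  qed
  then show ?thesis by (simp add: bij_def finite_UNIV_inj_surj)
qed

lemma permutation_finite_UNIV: "bij (\<pi> :: 'x::finite \<Rightarrow> 'x) \<Longrightarrow> permutation \<pi>"
  by (simp add: permutation)

section \<open>Parity of the action on the first level\<close>

definition root_sign :: "('x list \<Rightarrow> 'x list) \<Rightarrow> int" where
  "root_sign g = sign (root_perm g)"

lemma root_sign_comp:
  fixes g :: "'x::finite list \<Rightarrow> 'x list"
  assumes "tree_aut g" "tree_aut h"
  shows "root_sign (h \<circ> g) = root_sign h * root_sign g"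
  using assms
  by (simp add: root_sign_def root_perm_comp sign_compose permutation_finite_UNIV bij_root_perm)

lemma root_sign_id [simp]: "root_sign id = 1"
  by (simp add: root_sign_def)

text \<open>\<open>sign\<close> takes only these values on all functions, permutations or
  not.\<close>

lemma root_sign_cases: "root_sign g = 1 \<or> root_sign g = - 1"
  by (simp add: root_sign_def sign_def)

section \<open>Depth of portraits\<close>

text \<open>Induction on \<open>n\<close> with \<open>g\<close> varying: sections of
  \<open>sect g [i]\<close> from level \<open>n\<close> on are sections of \<open>g\<close> from
  level \<open>Suc n\<close> on. At level 0 the portrait is a single leaf.\<close>

lemma has_portrait_exists:
  assumes "\<And>u. length u \<ge> n \<Longrightarrow> sect g u \<in> N"
  shows "\<exists>p. has_portrait N g p"
  using assms
proof (induction n arbitrary: g)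
  case 0
  from 0[of "[]"] have "has_portrait N g (Leaf g)" by (auto intro: has_portrait.leaf)
  then show ?case ..
next
  case (Suc n)
  have "\<exists>p. has_portrait N (sect g [i]) p" for i
    by (rule Suc.IH) (use Suc.prems in \<open>simp flip: sect_Cons\<close>)
  then obtain p where "\<And>i. has_portrait N (sect g [i]) (p i)" by metis
  then show ?case by (metis has_portrait.leaf has_portrait.node)
qed

lemma has_nucleus_portrait:
  assumes "contracts_to G (nucleus G)" "g \<in> G"
  shows "has_portrait (nucleus G) g (nucleus_portrait G g)"
proof -
  obtain p where "has_portrait (nucleus G) g p"
    using assms has_portrait_exists unfolding contracts_to_def by metis
  then show ?thesis
    unfolding nucleus_portrait_def by (rule theI) (metis has_portrait_unique \<open>has_portrait _ g p\<close>)
qed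

lemma depth_le_0_iff:
  assumes "contracts_to G (nucleus G)" "g \<in> G"
  shows "depth G g \<le> 0 \<longleftrightarrow> g \<in> nucleus G"
  using has_nucleus_portrait[OF assms] unfolding depth_def
  by (auto elim!: has_portrait.cases)

text \<open>Outside the nucleus the subtrees of the portrait are the portraits of the sections.
  Inside it the portrait is a bare leaf, and closure of the nucleus under sections makes both sides
  true.\<close>

lemma depth_le_Suc_iff:
  assumes c: "contracts_to G (nucleus G)" and g: "g \<in> G"
    and G: "\<And>i. sect g [i] \<in> G"
    and N: "\<And>h i. h \<in> nucleus G \<Longrightarrow> sect h [i] \<in> nucleus G"
  shows "depth G g \<le> Suc n \<longleftrightarrow> (\<forall>i. depth G (sect g [i]) \<le> n)"
proof (cases "g \<in> nucleus G")
  case True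
  then have "depth G g \<le> 0" "\<And>i. depth G (sect g [i]) \<le> 0"
    using depth_le_0_iff[OF c] g G N by auto
  then show ?thesis by simp
next
  case False
  from has_nucleus_portrait[OF c g] False obtain p where
    p: "nucleus_portrait G g = Node (root_perm g) p"
    "\<And>i. has_portrait (nucleus G) (sect g [i]) (p i)"
    by (auto elim: has_portrait.cases)
  have "p i = nucleus_portrait G (sect g [i])" for i
    using p(2) has_nucleus_portrait[OF c G] has_portrait_unique by metis
  then show ?thesis by (simp add: depth_def p(1))
qed

section \<open>Generators and their inverses\<close>

text \<open>Inverting moves a section to the image of its vertex:
  \<open>x^-1 = (y^-1,1,1)(1 2)\<close> and \<open>y^-1 = (1,1,x^-1)(1 3)\<close>. Explicit
  recursions let words in the generators be evaluated by rewriting.\<close>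

fun apo_x' :: "letter list \<Rightarrow> letter list" and apo_y' :: "letter list \<Rightarrow> letter list" where
  "apo_x' [] = []"
| "apo_x' (X1 # w) = X2 # apo_y' w"
| "apo_x' (X2 # w) = X1 # w"
| "apo_x' (X3 # w) = X3 # w"
| "apo_y' [] = []"
| "apo_y' (X1 # w) = X3 # w"
| "apo_y' (X2 # w) = X2 # w"
| "apo_y' (X3 # w) = X1 # apo_x' w"

fun apo_z' :: "letter list \<Rightarrow> letter list" where
  "apo_z' [] = []"
| "apo_z' (X1 # w) = X1 # w"
| "apo_z' (X2 # w) = X3 # apo_z' w"
| "apo_z' (X3 # w) = X2 # w"

lemma apo_xy_inverse_apply [simp]:
  "apo_x (apo_x' w) = w" "apo_y (apo_y' w) = w" "apo_x' (apo_x w) = w" "apo_y' (apo_y w) = w"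
proof -
  have "apo_x (apo_x' w) = w \<and> apo_y (apo_y' w) = w \<and> apo_x' (apo_x w) = w \<and> apo_y' (apo_y w) = w"
  proof (induction w)
    case (Cons i w)
    then show ?case by (cases i) auto
  qed simp
  then show "apo_x (apo_x' w) = w" "apo_y (apo_y' w) = w"
    "apo_x' (apo_x w) = w" "apo_y' (apo_y w) = w" by auto
qed

lemma apo_z_inverse_apply [simp]: "apo_z (apo_z' w) = w" "apo_z' (apo_z w) = w"
proof -
  have "apo_z (apo_z' w) = w \<and> apo_z' (apo_z w) = w"
  proof (induction w)
    case (Cons i w)
    then show ?case by (cases i) auto
  qed simp
  then show "apo_z (apo_z' w) = w" "apo_z' (apo_z w) = w" by auto
qed

lemma apo_inverse [simp]:
  "apo_x \<circ> apo_x' = id" "apo_x' \<circ> apo_x = id" "apo_y \<circ> apo_y' = id" "apo_y' \<circ> apo_y = id"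
  "apo_z \<circ> apo_z' = id" "apo_z' \<circ> apo_z = id"
  by auto

definition apo_gens :: "(letter list \<Rightarrow> letter list) set" where
  "apo_gens = {apo_x, apo_y, apo_z, apo_x', apo_y', apo_z'}"

lemma apo_tree_autD: "g \<in> apollonian \<Longrightarrow> tree_aut g"
  using subgroup.subset[OF subgroup_apollonian] by (auto simp: AutT_def)

lemma id_apo [simp]: "id \<in> apollonian"
  using subgroup.one_closed[OF subgroup_apollonian] by (simp add: AutT_def)

lemma comp_apo: "g \<in> apollonian \<Longrightarrow> h \<in> apollonian \<Longrightarrow> g \<circ> h \<in> apollonian"
  \<comment> \<open>The product of \<open>AutT\<close> is reversed composition, hence the swapped
    factors.\<close>
  using subgroup.m_closed[OF subgroup_apollonian, of h g] by (simp add: AutT_def)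

lemma apo_inverse_exists:
  assumes "g \<in> apollonian"
  shows "\<exists>h\<in>apollonian. h \<circ> g = id \<and> g \<circ> h = id"
proof (intro bexI conjI)
  interpret group "AutT :: (letter list \<Rightarrow> letter list) monoid" by (rule group_AutT)
  have "g \<in> carrier AutT" using assms subgroup.subset[OF subgroup_apollonian] by auto
  from l_inv[OF this] r_inv[OF this]
  show "inv\<^bsub>AutT\<^esub> g \<circ> g = id" "g \<circ> inv\<^bsub>AutT\<^esub> g = id"
    by (simp_all add: AutT_def)
  show "inv\<^bsub>AutT\<^esub> g \<in> apollonian"
    using subgroup.m_inv_closed[OF subgroup_apollonian assms] .
qed

text \<open>A left inverse of \<open>g\<close> coincides with its two-sided inverse, which lies in
  the group.\<close>

lemma apo_inverseI:
  assumes "g \<in> apollonian" "h \<circ> g = id"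
  shows "h \<in> apollonian"
proof -
  obtain k where k: "k \<in> apollonian" "g \<circ> k = id" using apo_inverse_exists assms(1) by blast
  have "h = h \<circ> (g \<circ> k)" by (simp add: k)
  also have "\<dots> = k" using assms(2) by (simp flip: comp_assoc)
  finally show ?thesis using k by simp
qed

lemma apo_gens_apo: "s \<in> apo_gens \<Longrightarrow> s \<in> apollonian"
proof -
  have "apo_x \<in> apollonian" "apo_y \<in> apollonian" "apo_z \<in> apollonian"
    unfolding apollonian_def by (auto intro: generate.incl)
  then show "s \<in> apo_gens \<Longrightarrow> s \<in> apollonian"
    unfolding apo_gens_def using apo_inverseI apo_inverse by blast
qed

lemma apo_gen_apo [simp]:
  "apo_x \<in> apollonian" "apo_y \<in> apollonian" "apo_z \<in> apollonian"
  "apo_x' \<in> apollonian" "apo_y' \<in> apollonian" "apo_z' \<in> apollonian"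
  by (rule apo_gens_apo, simp add: apo_gens_def)+

text \<open>Induction on words over the symmetric set \<open>apo_gens\<close>, one letter at a time,
  instead of on products of two arbitrary elements.\<close>

lemma apollonian_induct [consumes 1, case_names id comp]:
  assumes g: "g \<in> apollonian" and one: "P id"
    and step: "\<And>g s. g \<in> apollonian \<Longrightarrow> P g \<Longrightarrow> s \<in> apo_gens \<Longrightarrow> P (s \<circ> g)"
  shows "P g"
proof -
  interpret group "AutT :: (letter list \<Rightarrow> letter list) monoid" by (rule group_AutT)
  have inv_gens: "inv\<^bsub>AutT\<^esub> s \<in> apo_gens" if "s \<in> {apo_x, apo_y, apo_z}" for s
  proof -
    have "inv\<^bsub>AutT\<^esub> apo_x = apo_x'" "inv\<^bsub>AutT\<^esub> apo_y = apo_y'" "inv\<^bsub>AutT\<^esub> apo_z = apo_z'"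
      by (rule inv_equality; use apo_tree_autD[of apo_x] apo_tree_autD[of apo_y]
          apo_tree_autD[of apo_z] apo_tree_autD[of apo_x'] apo_tree_autD[of apo_y']
          apo_tree_autD[of apo_z'] in \<open>simp add: AutT_def\<close>)+
    then show ?thesis using that by (auto simp: apo_gens_def)
  qed
  \<comment> \<open>With \<open>h\<close> general, the product case \<open>eng\<close> amounts to
    two successive multiplications; \<open>h = id\<close> gives the claim.\<close>
  have "\<forall>h\<in>apollonian. P h \<longrightarrow> P (g \<circ> h)"
    using g[unfolded apollonian_def]
  proof (induction g rule: generate.induct)
    case one
    then show ?case by (simp add: AutT_def)
  next
    case (incl s)
    then have "s \<in> apo_gens" by (auto simp: apo_gens_def)
    then show "\<forall>h\<in>apollonian. P h \<longrightarrow> P (s \<circ> h)" using step by blast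
  next
    case (inv s)
    then show "\<forall>h\<in>apollonian. P h \<longrightarrow> P (inv\<^bsub>AutT\<^esub> s \<circ> h)" using step inv_gens by blast
  next
    case (eng g1 g2)
    then have "g1 \<in> apollonian" by (simp add: apollonian_def)
    then have "\<forall>h\<in>apollonian. P h \<longrightarrow> P (g2 \<circ> (g1 \<circ> h))" using eng.IH comp_apo by blast
    then show "\<forall>h\<in>apollonian. P h \<longrightarrow> P ((g1 \<otimes>\<^bsub>AutT\<^esub> g2) \<circ> h)"
      by (simp add: AutT_def comp_assoc)
  qed
  then show ?thesis using one by force
qed

lemma apo_inverse_wreath [simp]:
  "sect apo_x' [X1] = apo_y'" "sect apo_x' [X2] = id" "sect apo_x' [X3] = id"
  "sect apo_y' [X1] = id" "sect apo_y' [X2] = id" "sect apo_y' [X3] = apo_x'"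
  "sect apo_z' [X1] = id" "sect apo_z' [X2] = apo_z'" "sect apo_z' [X3] = id"
  "root_perm apo_x' = transpose X1 X2"
  "root_perm apo_y' = transpose X1 X3"
  "root_perm apo_z' = transpose X2 X3"
proof -
  have "root_perm apo_x' i = transpose X1 X2 i" "root_perm apo_y' i = transpose X1 X3 i"
    "root_perm apo_z' i = transpose X2 X3 i" for i
    by (cases i; simp add: root_perm_def transpose_def)+
  then show "root_perm apo_x' = transpose X1 X2" "root_perm apo_y' = transpose X1 X3"
    "root_perm apo_z' = transpose X2 X3" by auto
qed (auto simp: sect_def fun_eq_iff)

declare apo_wreath [simp]

lemma root_sign_gens [simp]:
  "root_sign apo_x = - 1" "root_sign apo_y = - 1" "root_sign apo_z = - 1"
  "root_sign apo_x' = - 1" "root_sign apo_y' = - 1" "root_sign apo_z' = - 1"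
  by (simp_all add: root_sign_def sign_swap_id)

section \<open>The Apollonian group as a subgroup of its wreath product\<close>

lemma apo_gens_sect:
  assumes "s \<in> apo_gens"
  shows "sect s [i] \<in> insert id apo_gens"
  using assms by (cases i) (auto simp: apo_gens_def)

lemma apo_sect:
  assumes "g \<in> apollonian"
  shows "sect g [i] \<in> apollonian"
  using assms
proof (induction g rule: apollonian_induct)
  case (comp g s)
  then have "sect s (g [i]) \<in> apollonian"
    using apo_gens_sect[of s "root_perm g i"] apo_gens_apo
    by (auto simp: tree_aut_singleton[OF apo_tree_autD])
  then show "sect (s \<circ> g) [i] \<in> apollonian"
    using comp by (simp add: sect_comp apo_tree_autD apo_gens_apo comp_apo)
next
  case id
  show "sect id [i] \<in> apollonian" by simp
qed

text \<open>Both sides are multiplicative and equal -1 on generators and their inverses, each of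
  which has exactly one odd section.\<close>

lemma apo_root_sign:
  assumes "g \<in> apollonian"
  shows "root_sign g = (\<Prod>i\<in>UNIV. root_sign (sect g [i]))"
  using assms
proof (induction g rule: apollonian_induct)
  case (comp g s)
  have s: "root_sign s = (\<Prod>i\<in>UNIV. root_sign (sect s [i]))"
    using comp.hyps(2) by (auto simp: apo_gens_def UNIV_letter)
  have t: "tree_aut g" "tree_aut s" using comp by (auto simp: apo_tree_autD apo_gens_apo)
  have *: "sect s [i] \<in> apollonian" for i
    using comp by (simp add: apo_sect apo_gens_apo)
  have "(\<Prod>i\<in>UNIV. root_sign (sect (s \<circ> g) [i]))
      = (\<Prod>i\<in>UNIV. root_sign (sect s [root_perm g i])) * (\<Prod>i\<in>UNIV. root_sign (sect g [i]))"
    using comp * by (simp add: sect_comp t tree_aut_singleton root_sign_comp apo_tree_autD apo_sect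
        prod.distrib)
  \<comment> \<open>The action of \<open>g\<close> on the first level only reorders the
    factors.\<close>
  also have "(\<Prod>i\<in>UNIV. root_sign (sect s [root_perm g i])) = (\<Prod>i\<in>UNIV. root_sign (sect s [i]))"
    by (rule prod.reindex_bij_betw) (rule bij_root_perm[OF t(1)])
  finally have "(\<Prod>i\<in>UNIV. root_sign (sect (s \<circ> g) [i])) = root_sign s * root_sign g"
    unfolding s comp.IH .
  then show "root_sign (s \<circ> g) = (\<Prod>i\<in>UNIV. root_sign (sect (s \<circ> g) [i]))"
    unfolding root_sign_comp[OF t] ..
next
  case id
  show "root_sign id = (\<Prod>i\<in>UNIV. root_sign (sect id [i] :: letter list \<Rightarrow> letter list))" by simp
qed

section \<open>Elements acting below a single vertex of level 1\<close>

definition single :: "'x \<Rightarrow> ('x list \<Rightarrow> 'x list) \<Rightarrow> 'x list \<Rightarrow> 'x list" where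
  "single i g = wreath ((\<lambda>_. id)(i := g)) id"

lemma single_Nil [simp]: "single i g [] = []"
  and single_Cons: "single i g (j # w) = j # (if j = i then g w else w)"
  by (simp_all add: single_def)

lemma single_comp: "single i (g \<circ> h) = single i g \<circ> single i h"
  by (auto simp: single_def wreath_comp fun_eq_iff intro!: arg_cong[where f = "\<lambda>s. wreath s id _"])

lemma single_id [simp]: "single i id = id"
  unfolding single_def by (metis fun_upd_triv wreath_id)

lemma letter_list_cases:
  obtains "w = []" | v where "w = X1 # v" | v where "w = X2 # v" | v where "w = X3 # v"
  by (metis letter.exhaust list.exhaust)

text \<open>The words on the right-hand sides were found by a computer search in the free group.\<close>

lemma single_words:
  "single X1 (apo_x \<circ> apo_x)
     = apo_x' \<circ> apo_y' \<circ> apo_z' \<circ> apo_y \<circ> apo_z \<circ> apo_y \<circ> apo_x \<circ> apo_y"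
  "single X1 (apo_y \<circ> apo_x) = apo_z \<circ> apo_x \<circ> apo_z' \<circ> apo_y"
  "single X1 (apo_z \<circ> apo_x) = apo_x' \<circ> apo_z \<circ> apo_x \<circ> apo_y"
  "single X1 (apo_x' \<circ> apo_y) = apo_y' \<circ> apo_x' \<circ> apo_y' \<circ> apo_x \<circ> apo_y \<circ> apo_x"
  "single X1 (apo_x' \<circ> apo_z) = apo_z' \<circ> apo_y' \<circ> apo_z \<circ> apo_y \<circ> apo_z \<circ> apo_y'"
  by (rule ext; rule_tac w = x in letter_list_cases; simp add: single_Cons)+

lemma single_words_apo:
  "single X1 (apo_x \<circ> apo_x) \<in> apollonian" "single X1 (apo_y \<circ> apo_x) \<in> apollonian"
  "single X1 (apo_z \<circ> apo_x) \<in> apollonian" "single X1 (apo_x' \<circ> apo_y) \<in> apollonian"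
  "single X1 (apo_x' \<circ> apo_z) \<in> apollonian"
  unfolding single_words by (simp_all add: comp_apo)

lemma single_apo_inverse:
  assumes "single i g \<in> apollonian" "h \<circ> g = id"
  shows "single i h \<in> apollonian"
  by (rule apo_inverseI[OF assms(1)]) (simp add: assms(2) flip: single_comp)

text \<open>The elements \<open>s \<circ> apo_x\<close> and \<open>apo_x' \<circ> s\<close> are the
  Schreier generators of the even subgroup for the transversal \<open>{id, apo_x}\<close>.\<close>

lemma single_gens_apo:
  assumes "s \<in> apo_gens"
  shows "single X1 (s \<circ> apo_x) \<in> apollonian" "single X1 (apo_x' \<circ> s) \<in> apollonian"
proof -
  \<comment> \<open>Inverses of \<open>apo_x' \<circ> apo_y\<close> and
    \<open>apo_x' \<circ> apo_z\<close>, which are among the listed words.\<close>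
  have "single X1 (apo_y' \<circ> apo_x) \<in> apollonian" "single X1 (apo_z' \<circ> apo_x) \<in> apollonian"
    by (rule single_apo_inverse, rule single_words_apo, simp add: fun_eq_iff)+
  then show "single X1 (s \<circ> apo_x) \<in> apollonian"
    using assms single_words_apo by (auto simp: apo_gens_def)
  have "single X1 (apo_x' \<circ> apo_x') \<in> apollonian" "single X1 (apo_x' \<circ> apo_y') \<in> apollonian"
     "single X1 (apo_x' \<circ> apo_z') \<in> apollonian"
    by (rule single_apo_inverse, rule single_words_apo, simp add: fun_eq_iff)+
  then show "single X1 (apo_x' \<circ> s) \<in> apollonian"
    using assms single_words_apo by (auto simp: apo_gens_def)
qed

text \<open>Schreier rewriting: each further letter \<open>s\<close> exchanges the two alternatives,
  at the cost of one Schreier generator on the left.\<close>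

lemma single_X1_apo_cases:
  assumes "g \<in> apollonian"
  shows "single X1 g \<in> apollonian \<or> single X1 (apo_x' \<circ> g) \<in> apollonian"
  using assms
proof (induction g rule: apollonian_induct)
  case (comp g s)
  from comp.IH show "single X1 (s \<circ> g) \<in> apollonian \<or>
      single X1 (apo_x' \<circ> (s \<circ> g)) \<in> apollonian"
  proof
    assume "single X1 g \<in> apollonian"
    then have "single X1 ((apo_x' \<circ> s) \<circ> g) \<in> apollonian"
      unfolding single_comp[of _ "_ \<circ> _" g] using comp_apo single_gens_apo comp.hyps by blast
    then show ?thesis by (simp add: comp_assoc)
  next
    assume "single X1 (apo_x' \<circ> g) \<in> apollonian"
    then have "single X1 ((s \<circ> apo_x) \<circ> (apo_x' \<circ> g)) \<in> apollonian"
      unfolding single_comp[of _ "_ \<circ> _" "_ \<circ> g"] using comp_apo single_gens_apo comp.hyps by blast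
    also have "(s \<circ> apo_x) \<circ> (apo_x' \<circ> g) = s \<circ> g" by (simp add: fun_eq_iff)
    finally show ?thesis ..
  qed
next
  case id
  have "single X1 id \<in> apollonian" by simp
  then show "single X1 id \<in> apollonian \<or> single X1 (apo_x' \<circ> id) \<in> apollonian" ..
qed

text \<open>The parity law \<open>apo_root_sign\<close> applied to an element with trivial root
  permutation and all sections but one trivial.\<close>

lemma single_apo_root_sign:
  assumes "single i g \<in> apollonian"
  shows "root_sign g = 1"
proof -
  have "1 = (\<Prod>j\<in>UNIV. root_sign (((\<lambda>_. id)(i := g)) j))"
    using apo_root_sign[OF assms] by (simp add: single_def root_sign_def)
  also have "\<dots> = root_sign g" by (cases i) (simp_all add: UNIV_letter)
  finally show ?thesis by simp
qed

text \<open>For even \<open>g\<close> the product \<open>apo_x' \<circ> g\<close> is odd, so parity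
  excludes the second alternative of \<open>single_X1_apo_cases\<close>.\<close>

lemma single_even_apo:
  assumes "g \<in> apollonian" "root_sign g = 1"
  shows "single i g \<in> apollonian"
proof -
  have "\<not> single X1 (apo_x' \<circ> g) \<in> apollonian"
    using assms single_apo_root_sign[of X1 "apo_x' \<circ> g"]
    by (auto simp: root_sign_comp apo_tree_autD)
  then have 1: "single X1 g \<in> apollonian" using single_X1_apo_cases[OF assms(1)] by blast
  \<comment> \<open>\<open>apo_x\<close> carries \<open>X1\<close> to \<open>X2\<close> and
    \<open>apo_y'\<close> carries it to \<open>X3\<close>, both with trivial section at
    \<open>X1\<close>, so conjugation moves \<open>g\<close> unchanged.\<close>
  have "single X2 g = apo_x \<circ> single X1 g \<circ> apo_x'" "single X3 g = apo_y' \<circ> single X1 g \<circ> apo_y"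
    by (rule ext; rule_tac w = x in letter_list_cases; simp add: single_Cons)+
  then show ?thesis using 1 by (cases i) (simp_all add: comp_apo)
qed

lemma wreath_even_apo:
  assumes "\<And>i. s i \<in> apollonian" "\<And>i. root_sign (s i) = 1"
  shows "wreath s id \<in> apollonian"
proof -
  \<comment> \<open>The factors act on disjoint subtrees.\<close>
  have "wreath s id = single X1 (s X1) \<circ> single X2 (s X2) \<circ> single X3 (s X3)"
    by (rule ext; rule_tac w = x in letter_list_cases; simp add: single_Cons)
  then show ?thesis using assms by (simp add: comp_apo single_even_apo)
qed

section \<open>Permutations of three letters and realisable parities\<close>

lemma all_letter: "(\<forall>i. Q i) \<longleftrightarrow> Q X1 \<and> Q X2 \<and> Q X3"
  by (metis letter.exhaust)

text \<open>The first set is the alternating group, the second consists of the transpositions; they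
  are kept apart for counting by sign.\<close>

lemma bij_letter_cases:
  assumes "bij (\<alpha> :: letter \<Rightarrow> letter)"
  shows "\<alpha> \<in> {id, transpose X1 X2 \<circ> transpose X1 X3, transpose X1 X3 \<circ> transpose X1 X2}
    \<union> {transpose X1 X2, transpose X1 X3, transpose X2 X3}"
proof -
  have "\<alpha> X1 \<noteq> \<alpha> X2" "\<alpha> X1 \<noteq> \<alpha> X3" "\<alpha> X2 \<noteq> \<alpha> X3"
    using assms by (auto simp: bij_def dest: injD)
  then show ?thesis
    by (cases "\<alpha> X1"; cases "\<alpha> X2"; cases "\<alpha> X3") (simp_all add: fun_eq_iff all_letter transpose_def)
qed

lemma card_bij_letter_sign:
  assumes "s = 1 \<or> s = (- 1 :: int)"
  shows "card {\<alpha> :: letter \<Rightarrow> letter. bij \<alpha> \<and> sign \<alpha> = s} = 3"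
proof -
  let ?E = "{id, transpose X1 X2 \<circ> transpose X1 X3, transpose X1 X3 \<circ> transpose X1 X2}"
  let ?O = "{transpose X1 X2, transpose X1 X3, transpose X2 X3}"
  have E: "bij \<alpha> \<and> sign \<alpha> = 1" if "\<alpha> \<in> ?E" for \<alpha>
    using that by (auto simp: bij_comp sign_compose sign_swap_id permutation_finite_UNIV)
  have O: "bij \<alpha> \<and> sign \<alpha> = - 1" if "\<alpha> \<in> ?O" for \<alpha>
    using that by (auto simp: sign_swap_id)
  have "{\<alpha>. bij \<alpha> \<and> sign \<alpha> = s} = (if s = 1 then ?E else ?O)"
    using bij_letter_cases E O assms by (fastforce split: if_splits)
  moreover have "card ?E = 3"
  proof -
    \<comment> \<open>The image of \<open>X1\<close> separates the three elements, so there are at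
      least 3; the length of the listing bounds the number from above. The same works for
      \<open>?O\<close>.\<close>
    have "card ((\<lambda>\<alpha>. \<alpha> X1) ` ?E) = 3" by (simp add: transpose_def)
    then show ?thesis using card_image_le[of ?E "\<lambda>\<alpha>. \<alpha> X1"]
      card_length[of "[id, transpose X1 X2 \<circ> transpose X1 X3, transpose X1 X3 \<circ> transpose X1 X2]"]
      by simp
  qed
  moreover have "card ?O = 3"
  proof -
    have "card ((\<lambda>\<alpha>. \<alpha> X1) ` ?O) = 3" by (simp add: transpose_def)
    then show ?thesis using card_image_le[of ?O "\<lambda>\<alpha>. \<alpha> X1"]
      card_length[of "[transpose X1 X2, transpose X1 X3, transpose X2 X3]"]
      by simp
  qed
  ultimately show ?thesis by simp
qed

lemma apo_root_perm_surj:
  assumes "bij \<alpha>"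
  shows "\<exists>h\<in>apollonian. root_perm h = \<alpha>"
proof -
  have "\<alpha> \<in> root_perm ` {id, apo_x \<circ> apo_y, apo_y \<circ> apo_x, apo_x, apo_y, apo_z}"
    using bij_letter_cases[OF assms] by (simp add: root_perm_comp apo_tree_autD) blast
  moreover have "{id, apo_x \<circ> apo_y, apo_y \<circ> apo_x, apo_x, apo_y, apo_z} \<subseteq> apollonian"
    by (simp add: comp_apo)
  ultimately show ?thesis by blast
qed

lemma apo_squares:
  "apo_x \<circ> apo_x = wreath ((\<lambda>_. apo_y)(X3 := id)) id"
  "apo_y \<circ> apo_y = wreath ((\<lambda>_. apo_x)(X2 := id)) id"
  "apo_z \<circ> apo_z = wreath ((\<lambda>_. apo_z)(X1 := id)) id"
  by (rule ext; rule_tac w = x in letter_list_cases; simp)+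

text \<open>Product 1 means that no sign or exactly two signs are -1. The identity and the squares
  of the generators realise these four patterns.\<close>

lemma apo_stabilizer_signs:
  assumes \<epsilon>: "\<And>i. \<epsilon> i = 1 \<or> \<epsilon> i = (- 1 :: int)" and prod: "(\<Prod>i\<in>UNIV. \<epsilon> i) = 1"
  shows "\<exists>t. wreath t id \<in> apollonian \<and> (\<forall>i. root_sign (t i) = \<epsilon> i)"
proof -
  have mem: "wreath (\<lambda>_. id) id \<in> apollonian"
    "wreath ((\<lambda>_. apo_y)(X3 := id)) id \<in> apollonian"
    "wreath ((\<lambda>_. apo_x)(X2 := id)) id \<in> apollonian"
    "wreath ((\<lambda>_. apo_z)(X1 := id)) id \<in> apollonian"
    by (simp_all add: wreath_id comp_apo flip: apo_squares)
  have p: "\<epsilon> X1 * \<epsilon> X2 * \<epsilon> X3 = 1" using prod by (simp add: UNIV_letter mult.assoc)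
  then consider "\<epsilon> X1 = 1" "\<epsilon> X2 = 1" "\<epsilon> X3 = 1" | "\<epsilon> X1 = -1" "\<epsilon> X2 = -1" "\<epsilon> X3 = 1"
    | "\<epsilon> X1 = -1" "\<epsilon> X2 = 1" "\<epsilon> X3 = -1" | "\<epsilon> X1 = 1" "\<epsilon> X2 = -1" "\<epsilon> X3 = -1"
    using \<epsilon>[of X1] \<epsilon>[of X2] \<epsilon>[of X3] by auto
  then show ?thesis
  proof cases
    case 1
    then show ?thesis using mem(1) by (intro exI conjI) (assumption, simp add: all_letter)
  next
    case 2
    then show ?thesis using mem(2) by (intro exI conjI) (assumption, simp add: all_letter)
  next
    case 3
    then show ?thesis using mem(3) by (intro exI conjI) (assumption, simp add: all_letter)
  next
    case 4
    then show ?thesis using mem(4) by (intro exI conjI) (assumption, simp add: all_letter)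
  qed
qed

text \<open>Any group element \<open>k\<close> with root permutation \<alpha> is corrected by an
  element fixing the first level.\<close>

lemma apo_obtain_signs:
  assumes "bij \<alpha>" and \<epsilon>: "\<And>i. \<epsilon> i = 1 \<or> \<epsilon> i = (- 1 :: int)"
    and prod: "sign \<alpha> = (\<Prod>i\<in>UNIV. \<epsilon> i)"
  obtains h where "h \<in> apollonian" "root_perm h = \<alpha>" "\<And>i. root_sign (sect h [i]) = \<epsilon> i"
proof -
  obtain k where k: "k \<in> apollonian" "root_perm k = \<alpha>"
    using apo_root_perm_surj[OF assms(1)] by blast
  \<comment> \<open>Signs are their own inverses, so this is the discrepancy between the parities of
    \<open>k\<close> and the prescribed ones. Its product is 1 because both sets of signs multiply
    to \<open>sign \<alpha>\<close>.\<close>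
  define \<delta> where "\<delta> i = root_sign (sect k [i]) * \<epsilon> i" for i
  have \<delta>: "\<delta> i = 1 \<or> \<delta> i = - 1" for i
    using \<epsilon>[of i] root_sign_cases[of "sect k [i]"] by (auto simp: \<delta>_def)
  have "(\<Prod>i\<in>UNIV. \<delta> i) = root_sign k * sign \<alpha>"
    using k prod by (simp add: \<delta>_def prod.distrib apo_root_sign)
  also have "\<dots> = 1" using k by (simp add: root_sign_def)
  finally obtain t where t: "wreath t id \<in> apollonian" "\<And>i. root_sign (t i) = \<delta> i"
    using apo_stabilizer_signs[of \<delta>] \<delta> by blast
  have ta: "tree_aut k" "tree_aut (wreath t id)" using k t by (simp_all add: apo_tree_autD)
  have ts: "tree_aut (sect k [i])" "tree_aut (t i)" for i
    using apo_sect[OF k(1)] apo_sect[OF t(1)] by (auto simp: apo_tree_autD)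
  show thesis
  proof
    show "k \<circ> wreath t id \<in> apollonian" using k t by (simp add: comp_apo)
    show "root_perm (k \<circ> wreath t id) = \<alpha>" using k by (simp add: root_perm_comp ta)
    show "root_sign (sect (k \<circ> wreath t id) [i]) = \<epsilon> i" for i
    proof -
      have "sect (k \<circ> wreath t id) [i] = sect k [i] \<circ> t i"
        by (simp add: sect_comp ta tree_aut_singleton del: wreath.simps)
      then show ?thesis
        using t(2)[of i] root_sign_cases[of "sect k [i]"] ts by (auto simp: root_sign_comp \<delta>_def)
    qed
  qed
qed

text \<open>Parity is the only obstruction. For the converse, \<open>h\<close> in the group shares
  the permutation and section parities of \<open>wreath s \<alpha>\<close>; dividing by
  \<open>h\<close> leaves an element fixing level 1 with even sections, covered by
  \<open>wreath_even_apo\<close>.\<close>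

lemma wreath_apo_iff:
  "wreath s \<alpha> \<in> apollonian \<longleftrightarrow>
    (\<forall>i. s i \<in> apollonian) \<and> bij \<alpha> \<and> sign \<alpha> = (\<Prod>i\<in>UNIV. root_sign (s i))"
proof (intro iffI conjI allI)
  assume w: "wreath s \<alpha> \<in> apollonian"
  show "s i \<in> apollonian" for i using apo_sect[OF w] by simp
  show "bij \<alpha>" using bij_root_perm[OF apo_tree_autD[OF w]] by simp
  show "sign \<alpha> = (\<Prod>i\<in>UNIV. root_sign (s i))"
    using apo_root_sign[OF w] by (simp add: root_sign_def[of "wreath s \<alpha>"])
next
  assume a: "(\<forall>i. s i \<in> apollonian) \<and> bij \<alpha> \<and> sign \<alpha> = (\<Prod>i\<in>UNIV. root_sign (s i))"
  obtain h where h: "h \<in> apollonian" "root_perm h = \<alpha>"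
    "\<And>i. root_sign (sect h [i]) = root_sign (s i)"
    using apo_obtain_signs[of \<alpha> "\<lambda>i. root_sign (s i)"] root_sign_cases a by metis
  obtain k where k: "k \<in> apollonian" "k \<circ> h = id" "h \<circ> k = id"
    using apo_inverse_exists[OF h(1)] by blast
  define t where "t i = sect k [i]" for i
  define \<beta> where "\<beta> = root_perm k"
  have ta: "tree_aut h" "tree_aut k" using h k by (simp_all add: apo_tree_autD)
  have keq: "k = wreath t \<beta>" unfolding t_def[abs_def] \<beta>_def by (rule tree_aut_eq_wreath[OF ta(2)])
  have \<alpha>\<beta>: "\<alpha> \<circ> \<beta> = id" using root_perm_comp[OF ta(2,1)] k h by (simp add: \<beta>_def)
  have t: "t i \<in> apollonian" for i using apo_sect[OF k(1)] by (simp add: t_def)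
  \<comment> \<open>\<open>t i\<close> inverts the section of \<open>h\<close> at
    \<open>\<beta> i\<close>, which has the parity of \<open>s (\<beta> i)\<close>.\<close>
  have "root_sign (s (\<beta> i) \<circ> t i) = 1" for i
  proof -
    have "sect h [\<beta> i] \<circ> t i = id"
      using sect_comp[OF ta(2,1), of "[i]"] k by (simp add: \<beta>_def t_def tree_aut_singleton ta)
    then have "root_sign (sect h [\<beta> i]) * root_sign (t i) = 1"
      using t h by (metis apo_sect apo_tree_autD root_sign_comp root_sign_id)
    then show ?thesis using t a h by (simp add: root_sign_comp apo_tree_autD)
  qed
  then have "wreath (\<lambda>i. s (\<beta> i) \<circ> t i) id \<in> apollonian"
    using a t by (intro wreath_even_apo) (auto simp: comp_apo)
  then have "wreath s \<alpha> \<circ> k \<in> apollonian" by (simp add: keq wreath_comp \<alpha>\<beta>)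
  then have "wreath s \<alpha> \<circ> k \<circ> h \<in> apollonian" using h(1) by (rule comp_apo)
  then show "wreath s \<alpha> \<in> apollonian" using k by (simp add: comp_assoc)
qed

section \<open>The nucleus\<close>

definition apo_nucleus :: "(letter list \<Rightarrow> letter list) set" where
  "apo_nucleus = insert id apo_gens"

lemma apo_nucleus_sect:
  assumes "g \<in> apo_nucleus"
  shows "sect g u \<in> apo_nucleus"
  using assms
proof (induction u arbitrary: g)
  case (Cons i u)
  then have "sect g [i] \<in> apo_nucleus" using apo_gens_sect by (auto simp: apo_nucleus_def)
  then show ?case by (subst sect_Cons) (rule Cons.IH)
qed simp

lemma apo_nucleus_apo: "g \<in> apo_nucleus \<Longrightarrow> g \<in> apollonian"
  by (auto simp: apo_nucleus_def apo_gens_apo)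

lemma sect_apo_comp:
  assumes "g \<in> apollonian" "h \<in> apollonian"
  shows "sect (h \<circ> g) [i] = sect h [root_perm g i] \<circ> sect g [i]"
  using assms by (simp add: sect_comp apo_tree_autD tree_aut_singleton)

text \<open>Finite check over pairs. The six exceptional products form three pairs of mutual
  inverses.\<close>

lemma apo_nucleus_comp_sect1:
  assumes "g \<in> apo_nucleus" "h \<in> apo_nucleus"
  shows "sect (h \<circ> g) [i] \<in> apo_nucleus \<union>
    {apo_z \<circ> apo_x, apo_x' \<circ> apo_z', apo_y' \<circ> apo_x',
      apo_x \<circ> apo_y, apo_z' \<circ> apo_y', apo_y \<circ> apo_z}"
  using assms by (cases i) (auto simp: apo_nucleus_def apo_gens_def sect_apo_comp transpose_def)

text \<open>The sections of the six exceptional products lie in the nucleus, so a product of two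
  nucleus elements contracts within two levels.\<close>

lemma apo_nucleus_comp_sect2:
  assumes "g \<in> apo_nucleus" "h \<in> apo_nucleus"
  shows "sect (h \<circ> g) [i, j] \<in> apo_nucleus"
proof (cases "sect (h \<circ> g) [i] \<in> apo_nucleus")
  case True
  then show ?thesis unfolding sect_Cons[of _ i "[j]"] by (rule apo_nucleus_sect)
next
  case False
  then have "sect (h \<circ> g) [i] \<in> {apo_z \<circ> apo_x, apo_x' \<circ> apo_z', apo_y' \<circ> apo_x',
      apo_x \<circ> apo_y, apo_z' \<circ> apo_y', apo_y \<circ> apo_z}"
    using apo_nucleus_comp_sect1[OF assms] by blast
  then show ?thesis unfolding sect_Cons[of _ i "[j]"]
    by (cases j) (auto simp: apo_nucleus_def apo_gens_def sect_apo_comp transpose_def)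
qed

lemma apo_contracts_to: "contracts_to apollonian apo_nucleus"
  unfolding contracts_to_def
proof (intro conjI ballI)
  show "finite apo_nucleus" by (simp add: apo_nucleus_def apo_gens_def)
  show "apo_nucleus \<subseteq> apollonian" using apo_nucleus_apo by blast
  fix g assume "g \<in> apollonian"
  then show "\<exists>n. \<forall>u. length u \<ge> n \<longrightarrow> sect g u \<in> apo_nucleus"
  proof (induction g rule: apollonian_induct)
    case id
    show "\<exists>n. \<forall>u. length u \<ge> n \<longrightarrow> sect id u \<in> apo_nucleus" by (simp add: apo_nucleus_def)
  next
    case (comp g s)
    then obtain n where n: "\<And>u. length u \<ge> n \<Longrightarrow> sect g u \<in> apo_nucleus" by blast
    \<comment> \<open>At level \<open>n\<close> the section of \<open>s \<circ> g\<close> is a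
      product of two nucleus elements; two more levels bring it into the nucleus.\<close>
    have "sect (s \<circ> g) u \<in> apo_nucleus" if "length u \<ge> n + 2" for u
    proof -
      have "length (drop n u) \<ge> 2" using that by simp
      then obtain i j w where u: "drop n u = i # j # w"
        by (auto simp: numeral_2_eq_2 Suc_le_length_iff simp del: length_drop)
      have "sect (s \<circ> g) (take n u) = sect s (g (take n u)) \<circ> sect g (take n u)"
        using comp by (simp add: sect_comp apo_tree_autD apo_gens_apo)
      moreover have "sect s (g (take n u)) \<in> apo_nucleus"
        using comp by (intro apo_nucleus_sect) (simp add: apo_nucleus_def)
      moreover have "sect g (take n u) \<in> apo_nucleus" using that by (intro n) simp
      ultimately have "sect (sect (s \<circ> g) (take n u)) [i, j] \<in> apo_nucleus"
        using apo_nucleus_comp_sect2 by simp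
      then have "sect (sect (sect (s \<circ> g) (take n u)) [i, j]) w \<in> apo_nucleus"
        by (rule apo_nucleus_sect)
      then show ?thesis
        using u by (metis append_Cons append_Nil append_take_drop_id sect_append)
    qed
    then show "\<exists>n. \<forall>u. length u \<ge> n \<longrightarrow> sect (s \<circ> g) u \<in> apo_nucleus"
      by (intro exI[of _ "n + 2"]) simp
  qed
qed

lemma apo_contracting: "contracting apollonian"
proof -
  have "sect g u \<in> apollonian" if "g \<in> apollonian" for g u
    using that
  proof (induction u arbitrary: g)
    case (Cons i u)
    then show ?case by (subst sect_Cons) (simp add: apo_sect)
  qed simp
  then show ?thesis
    using subgroup_apollonian apo_contracts_to by (auto simp: contracting_def self_similar_def)
qed

text \<open>Such a \<open>g\<close> is its own section at every power of the word \<open>u\<close>,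
  hence at arbitrarily deep levels.\<close>

lemma recurrent_in_contracts_to:
  assumes "contracts_to G M" "g \<in> G" and u: "sect g u = g" "u \<noteq> []"
  shows "g \<in> M"
proof -
  have rep: "sect g (concat (replicate n u)) = g" for n
    by (induction n) (auto simp: sect_append u)
  obtain n where n: "\<forall>v. length v \<ge> n \<longrightarrow> sect g v \<in> M"
    using assms unfolding contracts_to_def by blast
  have "length (concat (replicate n u)) = n * length u"
    by (induction n) auto
  also have "\<dots> \<ge> n" using u by (cases u) auto
  finally show ?thesis using n rep by metis
qed

lemma nucleus_apollonian: "nucleus apollonian = apo_nucleus"
proof
  show "nucleus apollonian \<subseteq> apo_nucleus"
    by (rule nucleus_least(2)[OF apo_contracting apo_contracts_to])
  \<comment> \<open>The words trace cycles of sections: \<open>x\<close> and \<open>y\<close> are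
    sections of each other, as are their inverses, while \<open>z\<close> and \<open>z^-1\<close>
    are sections of themselves.\<close>
  have "sect apo_x [X2, X1] = apo_x" "sect apo_y [X1, X2] = apo_y" "sect apo_z [X3] = apo_z"
    "sect apo_x' [X1, X3] = apo_x'" "sect apo_y' [X3, X1] = apo_y'" "sect apo_z' [X2] = apo_z'"
    "sect id [X1] = id"
    by (simp_all add: sect_Cons[of _ _ "[_]"])
  then have "\<exists>u. u \<noteq> [] \<and> sect g u = g" if "g \<in> apo_nucleus" for g
    using that unfolding apo_nucleus_def apo_gens_def by blast
  then show "apo_nucleus \<subseteq> nucleus apollonian"
    using recurrent_in_contracts_to[OF nucleus_least(1)[OF apo_contracting]] apo_nucleus_apo
    by blast
qed

lemma card_apo_nucleus: "card apo_nucleus = 7"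
proof -
  \<comment> \<open>These two test words suffice to tell the seven elements apart.\<close>
  let ?e = "\<lambda>f. (f [X1, X1], f [X2, X2])"
  have "card (?e ` apo_nucleus) = 7" by (simp add: apo_nucleus_def apo_gens_def)
  moreover have "card apo_nucleus \<le> 7"
    using card_length[of "[id, apo_x, apo_y, apo_z, apo_x', apo_y', apo_z']"]
    by (simp add: apo_nucleus_def apo_gens_def)
  moreover have "card (?e ` apo_nucleus) \<le> card apo_nucleus"
    by (rule card_image_le) (simp add: apo_nucleus_def apo_gens_def)
  ultimately show ?thesis by simp
qed

section \<open>Counting\<close>

lemma apo_depth_le_0: "{g \<in> apollonian. depth apollonian g \<le> 0} = apo_nucleus"
  using depth_le_0_iff[OF nucleus_least(1)[OF apo_contracting]] apo_nucleus_apo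
  by (auto simp: nucleus_apollonian)

text \<open>Joins \<open>depth_le_Suc_iff\<close> to \<open>wreath_apo_iff\<close>. The dependent
  sum separates the free choice of three sections from that of \<alpha>, whose number of values will
  not depend on them.\<close>

lemma apo_depth_le_Suc:
  "{g \<in> apollonian. depth apollonian g \<le> Suc n} =
    (\<lambda>(s, \<alpha>). wreath s \<alpha>) ` (SIGMA s:{s. \<forall>i. s i \<in> {g \<in> apollonian. depth apollonian g \<le> n}}.
      {\<alpha>. bij \<alpha> \<and> sign \<alpha> = (\<Prod>i\<in>UNIV. root_sign (s i))})" (is "?L = ?R")
proof -
  have d: "depth apollonian g \<le> Suc n \<longleftrightarrow> (\<forall>i. depth apollonian (sect g [i]) \<le> n)"
    if "g \<in> apollonian" for g
    by (rule depth_le_Suc_iff[OF nucleus_least(1)[OF apo_contracting] that])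
      (use that in \<open>auto simp: apo_sect nucleus_apollonian apo_nucleus_sect\<close>)
  show ?thesis
  proof
    show "?R \<subseteq> ?L" using d wreath_apo_iff by auto
    show "?L \<subseteq> ?R"
    proof
      fix g assume g: "g \<in> ?L"
      define s where "s i = sect g [i]" for i
      have eq: "g = wreath s (root_perm g)"
        unfolding s_def[abs_def] using g by (intro tree_aut_eq_wreath apo_tree_autD) simp
      then have "wreath s (root_perm g) \<in> apollonian" using g by simp
      then show "g \<in> ?R"
        using g d[of g] eq unfolding wreath_apo_iff
        by (intro image_eqI[of _ _ "(s, root_perm g)"]) (auto simp: s_def)
    qed
  qed
qed

lemma inj_wreath: "inj (\<lambda>(s, \<alpha>). wreath s \<alpha>)"
proof (rule injI, clarify)
  fix s t :: "'x \<Rightarrow> 'x list \<Rightarrow> 'x list" and \<alpha> \<beta>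
  assume "wreath s \<alpha> = wreath t \<beta>"
  then show "s = t \<and> \<alpha> = \<beta>"
    by (metis root_perm_wreath sect_wreath ext)
qed

lemma card_functions_into:
  "card {s :: 'x::finite \<Rightarrow> 'b. \<forall>i. s i \<in> B} = card B ^ card (UNIV :: 'x set)"
  using card_funcsetE[of "UNIV :: 'x set" B] by (simp add: PiE_UNIV_domain Pi_def)

lemma portrait_growth_apo_0: "portrait_growth apollonian 0 = 7"
  unfolding portrait_growth_def apo_depth_le_0 card_apo_nucleus ..

text \<open>There are \<open>card ?B ^ 3\<close> triples of sections and three permutations of the
  forced sign for each. Positivity encodes finiteness, as \<open>card\<close> of an infinite set is
  0.\<close>

lemma portrait_growth_apo_Suc:
  assumes "portrait_growth apollonian n > 0"
  shows "portrait_growth apollonian (Suc n) = 3 * portrait_growth apollonian n ^ 3"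
proof -
  let ?B = "{g \<in> apollonian. depth apollonian g \<le> n}"
  let ?S = "{s :: letter \<Rightarrow> _. \<forall>i. s i \<in> ?B}"
  let ?P = "\<lambda>s. {\<alpha> :: letter \<Rightarrow> letter. bij \<alpha> \<and> sign \<alpha> = (\<Prod>i\<in>UNIV. root_sign (s i))}"
  have B: "finite ?B" using assms card_gt_0_iff unfolding portrait_growth_def by blast
  have cS: "card ?S = card ?B ^ 3"
    using card_functions_into[of ?B, where 'x = letter]
    by (simp only: UNIV_letter) (simp add: numeral_3_eq_3)
  have fS: "finite ?S"
    using assms cS by (intro card_ge_0_finite) (simp add: portrait_growth_def)
  have cP: "card (?P s) = 3" for s :: "letter \<Rightarrow> letter list \<Rightarrow> letter list"
  proof (rule card_bij_letter_sign)
    show "(\<Prod>i\<in>UNIV. root_sign (s i)) = 1 \<or> (\<Prod>i\<in>UNIV. root_sign (s i)) = - 1"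
      using root_sign_cases[of "s X1"] root_sign_cases[of "s X2"] root_sign_cases[of "s X3"]
      by (auto simp: UNIV_letter)
  qed
  have "portrait_growth apollonian (Suc n) = card (Sigma ?S ?P)"
    unfolding portrait_growth_def apo_depth_le_Suc
    by (rule card_image) (rule inj_on_subset[OF inj_wreath], simp)
  also have "\<dots> = (\<Sum>s\<in>?S. card (?P s))"
    using fS by (intro card_SigmaI) (auto simp: finite_subset[OF subset_UNIV])
  also have "\<dots> = 3 * card ?B ^ 3" by (simp only: cP sum_constant cS) simp
  finally show ?thesis by (simp add: portrait_growth_def)
qed

text \<open>The exponent of 3 under the recursion: cubing triples it and the factor 3 adds one. As
  \<open>3 ^ n\<close> is odd, the division is exact.\<close>

lemma half_pow3_Suc: "((3::nat) ^ Suc n - 1) div 2 = 3 * ((3 ^ n - 1) div 2) + 1"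
proof -
  have "odd ((3::nat) ^ n)" by simp
  then obtain k where "(3::nat) ^ n = 2 * k + 1" by (elim oddE)
  then show ?thesis by simp
qed

theorem theorem1p3:
  fixes n :: nat
  shows "portrait_growth apollonian n = 3 ^ ((3 ^ n - 1) div 2) * 7 ^ (3 ^ n)
    \<and> real (portrait_growth apollonian n) = 1 / sqrt 3 * (7 * sqrt 3) ^ (3 ^ n)"
proof
  show *: "portrait_growth apollonian n = 3 ^ ((3 ^ n - 1) div 2) * 7 ^ (3 ^ n)"
  proof (induction n)
    case 0
    show ?case by (simp add: portrait_growth_apo_0)
  next
    case (Suc n)
    \<comment> \<open>The closed form from the induction hypothesis also gives the required
      positivity.\<close>
    then have "portrait_growth apollonian (Suc n) = 3 * (3 ^ ((3 ^ n - 1) div 2) * 7 ^ (3 ^ n)) ^ 3"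
      by (simp add: portrait_growth_apo_Suc)
    then show ?case
      unfolding half_pow3_Suc by (simp add: power_mult_distrib power_add mult.commute flip: power_mult)
  qed
  have "odd ((3::nat) ^ n)" by simp
  \<comment> \<open>An odd power of \<open>sqrt 3\<close> is \<open>sqrt 3 * 3 ^ k\<close>, and the
    prefactor cancels the remaining root.\<close>
  then obtain k where k: "(3::nat) ^ n = 2 * k + 1" by (elim oddE)
  have "1 / sqrt 3 * (7 * sqrt 3) ^ (3 ^ n) = 3 ^ k * 7 ^ (3 ^ n)"
  proof -
    have "(7 * sqrt 3) ^ (3 ^ n) = 7 ^ (3 ^ n) * (sqrt 3 * 3 ^ k)"
      by (simp only: k power_mult_distrib) (simp add: power_mult)
    then show ?thesis by simp
  qed
  then show "real (portrait_growth apollonian n) = 1 / sqrt 3 * (7 * sqrt 3) ^ (3 ^ n)"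
    unfolding * by (simp add: k)
qed

end
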